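(* Let $T\ge1$ be an integer, let $\lambda\in\mathbb{R}$ with $\lambda<\lambda_1$, where $\lambda_1=2-2\cos\left(\frac{\pi}{T+1}\right)$, let $h:[1,T]\to\mathbb{R}$ and $B\in\mathbb{R}$. Suppose $y:[0,T+1]\to\mathbb{R}$ satisfies $$-\Delta^2y(t-1)-\lambda y(t)=h(t),\quad t\in[1,T],\qquad y(0)=0,\quad y(T+1)=B,$$ with $h(t)\ge0$ for all $t\in[1,T]$ and $B\ge0$. Then $y(t)\ge0$ for all $t\in[1,T]$.
   Context: For integers $a\le b$, $[a,b]$ denotes the discrete interval $\{a,a+1,\dots,b\}$. $\Delta$ is the forward difference operator, $\Delta y(t)=y(t+1)-y(t)$, so $\Delta^2y(t-1)=y(t+1)-2y(t)+y(t-1)$. The number $\lambda_1$ is the first eigenvalue of $\Delta^2y(t-1)+\lambda y(t)=0$ on $[1,T]$, $y(0)=y(T+1)=0$. *)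

theory Defs
  imports Complex_Main
begin

definition fdiff :: "(nat \<Rightarrow> real) \<Rightarrow> nat \<Rightarrow> real"
  where "fdiff y t = y (t + 1) - y t"

lemma fdiff_fdiff:
  assumes "t \<ge> 1"
  shows "fdiff (fdiff y) (t - 1) = y (t + 1) - 2 * y t + y (t - 1)"
  using assms by (simp add: fdiff_def)

text \<open>Functions on a discrete interval starting at \<open>0\<close> or \<open>1\<close> are represented by functions on
  \<^typ>\<open>nat\<close> whose values outside the interval are unconstrained. The index \<open>t - 1\<close> only occurs
  for \<open>t \<ge> 1\<close>, so the subtraction never truncates.\<close>

definition dirichlet_eigenvalue :: "nat \<Rightarrow> real \<Rightarrow> bool"
  where "dirichlet_eigenvalue T \<mu> \<longleftrightarrow>
    (\<exists>y. (\<forall>t\<in>{1..T}. fdiff (fdiff y) (t - 1) + \<mu> * y t = 0) \<and> y 0 = 0 \<and> y (T + 1) = 0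
       \<and> (\<exists>t\<in>{0..T + 1}. y t \<noteq> 0))"

text \<open>The closed form \<open>2 - 2 cos (\<pi> / (T + 1))\<close> is the first (smallest) Dirichlet eigenvalue,
  with eigenfunction \<open>sin (\<pi> t / (T + 1))\<close>.\<close>

lemma sin_recurrence:
  fixes a :: real
  assumes "t \<ge> 1"
  shows "sin (a * real (t + 1)) + sin (a * real (t - 1)) = 2 * cos a * sin (a * real t)"
proof -
  have 1: "a * real (t + 1) = a * real t + a" "a * real (t - 1) = a * real t - a"
    using assms by (simp_all add: algebra_simps of_nat_diff)
  show ?thesis unfolding 1 sin_add sin_diff by simp
qed

lemma first_eigenvalue_is_eigenvalue:
  assumes "T \<ge> 1"
  shows "dirichlet_eigenvalue T (2 - 2 * cos (pi / (real T + 1)))"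
proof -
  define a where "a = pi / (real T + 1)"
  define s where "s = (\<lambda>t::nat. sin (a * real t))"
  have "fdiff (fdiff s) (t - 1) + (2 - 2 * cos a) * s t = 0" if "t \<in> {1..T}" for t
    using sin_recurrence[of t a] that fdiff_fdiff[of t s] by (simp add: s_def algebra_simps)
  moreover have "s 0 = 0" by (simp add: s_def)
  moreover have "a * real (T + 1) = pi" by (simp add: a_def field_simps)
  then have "s (T + 1) = 0" by (simp only: s_def sin_pi)
  moreover have "s 1 > 0"
    using assms by (auto simp: s_def a_def field_simps intro!: sin_gt_zero)
  then have "\<exists>t\<in>{0..T + 1}. s t \<noteq> 0" by (intro bexI[of _ 1]) auto
  ultimately show ?thesis unfolding dirichlet_eigenvalue_def a_def[symmetric] by blast
qed

lemma first_eigenvalue_le: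
  assumes T: "T \<ge> 1" and ev: "dirichlet_eigenvalue T \<mu>"
  shows "2 - 2 * cos (pi / (real T + 1)) \<le> \<mu>"
proof -
  define a where "a = pi / (real T + 1)"
  define s where "s = (\<lambda>t::nat. sin (a * real t))"
  obtain y where eq: "\<And>t. t \<in> {1..T} \<Longrightarrow> fdiff (fdiff y) (t - 1) + \<mu> * y t = 0"
    and y0: "y 0 = 0" "y (T + 1) = 0" and nz: "\<exists>t\<in>{0..T + 1}. y t \<noteq> 0"
    using ev unfolding dirichlet_eigenvalue_def by blast
  have aT: "a * real (T + 1) = pi" by (simp add: a_def field_simps)
  have s0: "s 0 = 0" "s (T + 1) = 0"
    using aT by (simp add: s_def, simp only: s_def sin_pi)
  have apos: "a > 0" by (simp add: a_def add_nonneg_pos)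
  have spos: "s t > 0" if "t \<in> {1..T}" for t
  proof -
    have "a * real t < a * real (T + 1)"
      using that apos by (intro mult_strict_left_mono) auto
    then have "a * real t < pi" unfolding aT .
    then show ?thesis
      unfolding s_def using that apos by (intro sin_gt_zero) auto
  qed
  define f where "f = (\<lambda>t. \<bar>y t\<bar> / s t)"
  have "Max (f ` {1..T}) \<in> f ` {1..T}" using T by (intro Max_in) auto
  then obtain m where m: "m \<in> {1..T}" "f m = Max (f ` {1..T})" by fastforce
  have max: "f t \<le> f m" if "t \<in> {1..T}" for t using that m(2) by simp
  have bd: "\<bar>y t\<bar> \<le> f m * s t" if "t \<le> T + 1" for t
  proof (cases "t \<in> {1..T}")
    case True
    then show ?thesis using max[OF True] spos[OF True] by (simp add: f_def pos_divide_le_eq)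
  next
    case False
    then have "t = 0 \<or> t = T + 1" using that by auto
    then show ?thesis using y0 s0 by auto
  qed
  have "y m \<noteq> 0"
  proof
    assume "y m = 0"
    then have "f m = 0" by (simp add: f_def)
    then show False using bd nz by auto
  qed
  have ym: "\<bar>y m\<bar> = f m * s m" using spos[OF m(1)] by (simp add: f_def)
  have fpos: "f m * s m > 0" using ym \<open>y m \<noteq> 0\<close> by linarith
  have rec: "(2 - \<mu>) * y m = y (m + 1) + y (m - 1)"
    using eq[OF m(1)] m(1) fdiff_fdiff[of m y] by (simp add: algebra_simps)
  have "(2 - \<mu>) * \<bar>y m\<bar> \<le> \<bar>(2 - \<mu>) * y m\<bar>"
    unfolding abs_mult by (intro mult_right_mono) auto
  also have "\<dots> \<le> \<bar>y (m + 1)\<bar> + \<bar>y (m - 1)\<bar>" unfolding rec by linarith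
  also have "\<dots> \<le> f m * s (m + 1) + f m * s (m - 1)"
    using m(1) by (intro add_mono bd) auto
  also have "\<dots> = 2 * cos a * (f m * s m)"
    using sin_recurrence[of m a] m(1)
    by (simp add: s_def distrib_left[symmetric] del: of_nat_add of_nat_diff of_nat_Suc)
  finally have "(2 - \<mu>) * (f m * s m) \<le> 2 * cos a * (f m * s m)" unfolding ym .
  then have "2 - \<mu> \<le> 2 * cos a" using fpos by (simp only: mult_le_cancel_right_pos)
  then show ?thesis by (simp add: a_def)
qed

end

theory Submission imports Defs begin

text \<open>Compare \<open>y\<close> with the first eigenfunction \<open>s t = sin (\<pi> t / (T + 1))\<close>, which is positive on
  \<open>[1, T]\<close>. If the minimum \<open>c\<close> of \<open>y / s\<close> over \<open>[1, T]\<close> is negative, attained at \<open>m\<close>, then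
  \<open>y \<ge> c s\<close> on \<open>[0, T + 1]\<close> with equality at \<open>m\<close>, and the equation at \<open>m\<close> gives
  \<open>(2 - \<lambda>) y m \<ge> c (s (m + 1) + s (m - 1)) = (2 - \<lambda>\<^sub>1) y m\<close>, hence \<open>\<lambda> \<ge> \<lambda>\<^sub>1\<close>.\<close>

theorem proposition3p1:
  fixes T :: nat and lam lam1 B :: real and h y :: "nat \<Rightarrow> real"
  assumes "T \<ge> 1"
    and "lam1 = 2 - 2 * cos (pi / (real T + 1))"
    and "lam < lam1"
    and "\<forall>t\<in>{1..T}. - fdiff (fdiff y) (t - 1) - lam * y t = h t"
    and "y 0 = 0"
    and "y (T + 1) = B"
    and "\<forall>t\<in>{1..T}. h t \<ge> 0"
    and "B \<ge> 0"
  shows "\<forall>t\<in>{1..T}. y t \<ge> 0"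
proof -
  define a where "a = pi / (real T + 1)"
  define s where "s = (\<lambda>t::nat. sin (a * real t))"
  have aT: "a * real (T + 1) = pi" by (simp add: a_def field_simps)
  have s0: "s 0 = 0" "s (T + 1) = 0"
    using aT by (simp add: s_def, simp only: s_def sin_pi)
  have apos: "a > 0" by (simp add: a_def add_nonneg_pos)
  have spos: "s t > 0" if "t \<in> {1..T}" for t
  proof -
    have "a * real t < a * real (T + 1)"
      using that apos by (intro mult_strict_left_mono) auto
    then have "a * real t < pi" unfolding aT .
    then show ?thesis
      unfolding s_def using that apos by (intro sin_gt_zero) auto
  qed
  define f where "f = (\<lambda>t. y t / s t)"
  have "Min (f ` {1..T}) \<in> f ` {1..T}" using assms(1) by (intro Min_in) auto
  then obtain m where m: "m \<in> {1..T}" "f m = Min (f ` {1..T})" by fastforce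
  have min: "f m \<le> f t" if "t \<in> {1..T}" for t using that m(2) by simp
  \<comment> \<open>At both endpoints \<open>s\<close> vanishes, so there the bound only asks that
    \<open>y 0\<close> and \<open>B\<close> be nonnegative.\<close>
  have bd: "f m * s t \<le> y t" if "t \<le> T + 1" for t
  proof (cases "t \<in> {1..T}")
    case True
    then show ?thesis using min[OF True] spos[OF True] by (simp add: f_def pos_le_divide_eq)
  next
    case False
    then have "t = 0 \<or> t = T + 1" using that by auto
    then show ?thesis using assms(5,6,8) s0 by auto
  qed
  have ym: "y m = f m * s m" using spos[OF m(1)] by (simp add: f_def)
  have "f m \<ge> 0"
  proof (rule ccontr)
    assume "\<not> f m \<ge> 0"
    then have neg: "y m < 0" using ym spos[OF m(1)] by (simp add: mult_neg_pos)
    have "2 * cos a * y m = f m * s (m + 1) + f m * s (m - 1)"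
      using sin_recurrence[of m a] m(1) unfolding ym
      by (simp add: s_def distrib_left[symmetric] del: of_nat_add of_nat_diff of_nat_Suc)
    \<comment> \<open>A neighbour of \<open>m\<close> may be \<open>0\<close> or
      \<open>T + 1\<close>, which is why \<open>bd\<close> includes the boundary points.\<close>
    also have "\<dots> \<le> y (m + 1) + y (m - 1)"
      using m(1) by (intro add_mono bd) auto
    also have "\<dots> = (2 - lam) * y m - h m"
      using bspec[OF assms(4) m(1)] m(1) fdiff_fdiff[of m y] by (simp add: algebra_simps)
    also have "\<dots> \<le> (2 - lam) * y m" using assms(7) m(1) by simp
    \<comment> \<open>Cancelling the negative factor \<open>y m\<close> reverses the inequality; the
      result is \<open>lam \<ge> lam1\<close>.\<close>
    finally have "2 - lam \<le> 2 * cos a" using neg by (simp only: mult_le_cancel_right_neg)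
    then show False using assms(2,3) by (simp add: a_def)
  qed
  show ?thesis
  proof
    fix t assume t: "t \<in> {1..T}"
    have "0 \<le> f m * s t"
      using \<open>f m \<ge> 0\<close> spos[OF t] by simp
    also have "\<dots> \<le> y t" using t by (intro bd) auto
    finally show "0 \<le> y t" .
  qed
qed

end
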